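(* Let $\mathcal F$ and $\mathcal G$ be closed subspaces of a Hilbert space $\mathcal H$, with orthogonal projections $P_{\mathcal F}$ and $P_{\mathcal G}$. Let $(X,d)$ be a metric space with two Borel measures $\mu$ and $\nu$. Let $\{f_x\}_{x\in (X,d,\mu)}$ and $\{g_x\}_{x\in (X,d,\nu)}$ be continuous frames for $\mathcal F$ and $\mathcal G$ respectively, with canonical dual continuous frames $\{\widetilde{f_x}\}$ and $\{\widetilde{g_x}\}$, satisfying the following localization property. (L) For any $\epsilon>0$ there exists $R>0$ such that for all $r\ge R$ and every ball $B=B(a,r)$, $a\in X$, $$\left| \int_{B^c}\int_{B}\langle g_x,f_y\rangle\langle \widetilde{f_y},\widetilde{g_x}\rangle\, d\mu(y)\,d\nu(x)-\int_{B^c}\int_{B}\langle g_x,f_y\rangle\langle \widetilde{f_y},\widetilde{g_x}\rangle\, d\nu(x)\,d\mu(y)\right|<\epsilon\,(\mu+\nu)(B).$$ (In the first term $y\in B$, $x\in B^c$; in the second $x\in B$, $y\in B^c$.) Then the following hold. (i) If $|\langle P_{\mathcal F}g_x,\widetilde{g_x}\rangle|\le 1$ for all $x\in\operatorname{supp}(\nu)$, then $$D^-_\mu(\nu)\ge \liminf_{r\to\infty}\inf_{a\in X}\frac{1}{\mu(B(a,r))}\left|\int_{B(a,r)}\langle P_{\mathcal G}\widetilde{f_y},f_y\rangle\,d\mu(y)\right|,$$ $$D^+_\mu(\nu)\ge \limsup_{r\to\infty}\sup_{a\in X}\frac{1}{\mu(B(a,r))}\left|\int_{B(a,r)}\langle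 P_{\mathcal G}\widetilde{f_y},f_y\rangle\,d\mu(y)\right|.$$ (ii) If $\langle P_{\mathcal G}\widetilde{f_y},f_y\rangle\ge 1$ for all $y\in\operatorname{supp}(\mu)$, then $$D^+_\nu(\mu)\le \limsup_{r\to\infty}\sup_{a\in X}\frac{1}{\nu(B(a,r))}\left|\int_{B(a,r)}\langle P_{\mathcal F}g_x,\widetilde{g_x}\rangle\,d\nu(x)\right|,$$ $$D^-_\nu(\mu)\le \liminf_{r\to\infty}\inf_{a\in X}\frac{1}{\nu(B(a,r))}\left|\int_{B(a,r)}\langle P_{\mathcal F}g_x,\widetilde{g_x}\rangle\,d\nu(x)\right|.$$ (iii) If $|\langle P_{\mathcal F}g_x,\widetilde{g_x}\rangle|\le 1$ for all $x\in\operatorname{supp}(\nu)$ and $\langle P_{\mathcal G}\widetilde{f_y},f_y\rangle\ge 1$ for all $y\in\operatorname{supp}(\mu)$, then $$D^-_\mu(\nu)\ge 1,\qquad D^+_\nu(\mu)\le 1.$$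
   Context: Continuous frames: a family $\{f_x\}_{x\in(X,d,\mu)}$ of vectors in a Hilbert space $\mathcal F$, indexed by a metric space $(X,d)$ with a Borel measure $\mu$, is a continuous frame for $\mathcal F$ if there are $0<c\le C<\infty$ with $c\|f\|^2\le\int_X|\langle f,f_x\rangle|^2\,d\mu(x)\le C\|f\|^2$ for all $f\in\mathcal F$. Its frame operator is $S:\mathcal F\to\mathcal F$, $Sf=\int_X\langle f,f_x\rangle f_x\,d\mu(x)$ (weak integral: $\langle Sf,g\rangle=\int_X\langle f,f_x\rangle\langle f_x,g\rangle\, d\mu(x)$ for all $g\in\mathcal F$), and its canonical dual continuous frame is $\widetilde{f_x}=S^{-1}f_x$. Densities: $B(a,r)$ is the ball of center $a$ and radius $r$ in $(X,d)$, and $B^c$ is the complement of $B$ in $X$. For Borel measures $\mu,\nu$ on $(X,d)$, where it is assumed that there exists a large enough $R>0$ such that $\nu(B(a,R))>0$ for all $a\in X$, the upper and lower densities of $\mu$ with respect to $\nu$ are $$D^+_\nu(\mu)=\limsup_{r\to\infty}\sup_{a\in X}\frac{\mu(B(a,r))}{\nu(B(a,r))},\qquad D^-_\nu(\mu)=\liminf_{r\to\infty}\inf_{a\in X}\frac{\mu(B(a,r))}{\nu(B(a,r))}.$$ $D^\pm_\mu(\nu)$ are defined in the same way with the roles of $\mu$ and $\nu$ interchanged.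
   Formalization: Added hypotheses: μ and ν are finite on balls; the complements of supp(μ) and supp(ν) are null sets; and the kernel ⟨g_x,f_y⟩⟨f̃_y,g̃_x⟩ is absolutely integrable for ν×μ over B×X and X×B for every ball B. Without integrability (ii) and (iii) can fail. *)

theory Defs
  imports "HOL-Analysis.Analysis"
begin

section \<open>Complex Hilbert spaces\<close>

text \<open>
  The distribution only has real inner product spaces.  A complex Hilbert space is a complete real
  inner product space with a compatible complex scalar multiplication and a sesquilinear form
  (linear in the first argument) whose real part is the underlying real inner product.
\<close>

class chilbert_space = real_inner + complete_space +
  fixes scaleC :: "complex \<Rightarrow> 'a \<Rightarrow> 'a" (infixr \<open>*\<^sub>C\<close> 75)
    and cinner :: "'a \<Rightarrow> 'a \<Rightarrow> complex"
  assumes scaleC_add_right: "a *\<^sub>C (x + y) = a *\<^sub>C x + a *\<^sub>C y"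
    and scaleC_add_left: "(a + b) *\<^sub>C x = a *\<^sub>C x + b *\<^sub>C x"
    and scaleC_scaleC: "a *\<^sub>C (b *\<^sub>C x) = (a * b) *\<^sub>C x"
    and scaleC_of_real: "complex_of_real r *\<^sub>C x = r *\<^sub>R x"
    and cinner_commute: "cinner x y = cnj (cinner y x)"
    and cinner_add_left: "cinner (x + y) z = cinner x z + cinner y z"
    and cinner_scaleC_left: "cinner (a *\<^sub>C x) y = a * cinner x y"
    and Re_cinner: "Re (cinner x y) = inner x y"

instantiation complex :: chilbert_space
begin

definition scaleC_complex :: "complex \<Rightarrow> complex \<Rightarrow> complex"
  where "scaleC_complex a x = a * x"

definition cinner_complex :: "complex \<Rightarrow> complex \<Rightarrow> complex"
  where "cinner_complex x y = x * cnj y"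

instance
  by standard
    (auto simp: scaleC_complex_def cinner_complex_def algebra_simps scaleR_conv_of_real
      inner_complex_def)

end

definition closed_csubspace :: "'h::chilbert_space set \<Rightarrow> bool"
  where "closed_csubspace F \<longleftrightarrow>
    closed F \<and> 0 \<in> F \<and> (\<forall>x\<in>F. \<forall>y\<in>F. x + y \<in> F) \<and> (\<forall>a. \<forall>x\<in>F. a *\<^sub>C x \<in> F)"

definition orth_proj :: "'h::chilbert_space set \<Rightarrow> 'h \<Rightarrow> 'h"
  where "orth_proj F h = (THE p. p \<in> F \<and> (\<forall>g\<in>F. cinner (h - p) g = 0))"

section \<open>Continuous frames\<close>

text \<open>Weak measurability is what gives the integrals in the frame condition and in the frame
  operator a meaning.\<close>

definition continuous_frame ::
    "'x measure \<Rightarrow> 'h::chilbert_space set \<Rightarrow> ('x \<Rightarrow> 'h) \<Rightarrow> bool"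
  where "continuous_frame \<mu> F f \<longleftrightarrow>
    (\<forall>x. f x \<in> F) \<and>
    (\<forall>h\<in>F. (\<lambda>x. cinner h (f x)) \<in> borel_measurable \<mu>) \<and>
    (\<exists>c C :: real. 0 < c \<and> c \<le> C \<and>
      (\<forall>h\<in>F. ennreal (c * (norm h)\<^sup>2) \<le> (\<integral>\<^sup>+ x. ennreal ((cmod (cinner h (f x)))\<^sup>2) \<partial>\<mu>) \<and>
              (\<integral>\<^sup>+ x. ennreal ((cmod (cinner h (f x)))\<^sup>2) \<partial>\<mu>) \<le> ennreal (C * (norm h)\<^sup>2)))"

definition frame_op ::
    "'x measure \<Rightarrow> 'h::chilbert_space set \<Rightarrow> ('x \<Rightarrow> 'h) \<Rightarrow> 'h \<Rightarrow> 'h"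
  where "frame_op \<mu> F f h =
    (THE s. s \<in> F \<and> (\<forall>g\<in>F. cinner s g = (LINT x|\<mu>. cinner h (f x) * cinner (f x) g)))"

definition canonical_dual ::
    "'x measure \<Rightarrow> 'h::chilbert_space set \<Rightarrow> ('x \<Rightarrow> 'h) \<Rightarrow> 'x \<Rightarrow> 'h"
  where "canonical_dual \<mu> F f x = inv_into F (frame_op \<mu> F f) (f x)"

section \<open>Borel measures and densities\<close>

text \<open>Finiteness on balls and positivity on large balls are what make the quotients in the densities
  meaningful for large radii: neither \<open>0 / 0\<close> nor \<open>\<infinity> / \<infinity>\<close> occurs.\<close>

definition finite_on_balls :: "'x::metric_space measure \<Rightarrow> bool"
  where "finite_on_balls \<mu> \<longleftrightarrow> (\<forall>a r. emeasure \<mu> (ball a r) < \<infinity>)"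

definition large_balls_positive :: "'x::metric_space measure \<Rightarrow> bool"
  where "large_balls_positive \<mu> \<longleftrightarrow> (\<exists>R>0. \<forall>a. emeasure \<mu> (ball a R) > 0)"

text \<open>On a separable metric space the complement of the support is automatically a null set; on an
  arbitrary metric space this cannot be proved (it fails if there is a real-valued measurable
  cardinal), so it has to be assumed where it is needed.\<close>

definition measure_support :: "'x::topological_space measure \<Rightarrow> 'x set"
  where "measure_support \<mu> = {x. \<forall>U. open U \<and> x \<in> U \<longrightarrow> emeasure \<mu> U > 0}"

text \<open>In both densities the first argument is the reference measure, that is, the subscript of
  \<open>D\<close>: \<open>upper_density \<nu> \<mu>\<close> is the upper density of \<open>\<mu>\<close> with respect to \<open>\<nu>\<close>.\<close>

definition upper_density :: "'x::metric_space measure \<Rightarrow> 'x measure \<Rightarrow> ennreal"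
  where "upper_density \<nu> \<mu> =
    Limsup at_top (\<lambda>r::real. SUP a. emeasure \<mu> (ball a r) / emeasure \<nu> (ball a r))"

definition lower_density :: "'x::metric_space measure \<Rightarrow> 'x measure \<Rightarrow> ennreal"
  where "lower_density \<nu> \<mu> =
    Liminf at_top (\<lambda>r::real. INF a. emeasure \<mu> (ball a r) / emeasure \<nu> (ball a r))"

definition upper_ball_average :: "'x::metric_space measure \<Rightarrow> ('x \<Rightarrow> complex) \<Rightarrow> ennreal"
  where "upper_ball_average \<mu> \<phi> =
    Limsup at_top (\<lambda>r::real. SUP a.
      ennreal (cmod (LINT y:ball a r|\<mu>. \<phi> y)) / emeasure \<mu> (ball a r))"

definition lower_ball_average :: "'x::metric_space measure \<Rightarrow> ('x \<Rightarrow> complex) \<Rightarrow> ennreal"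
  where "lower_ball_average \<mu> \<phi> =
    Liminf at_top (\<lambda>r::real. INF a.
      ennreal (cmod (LINT y:ball a r|\<mu>. \<phi> y)) / emeasure \<mu> (ball a r))"

section \<open>Localization\<close>

text \<open>The integrand of the localization property; \<open>x\<close> is always the \<open>\<nu>\<close>-variable and \<open>y\<close> the
  \<open>\<mu>\<close>-variable.\<close>

definition frame_kernel ::
    "'x measure \<Rightarrow> 'x measure \<Rightarrow> 'h::chilbert_space set \<Rightarrow> 'h set \<Rightarrow>
     ('x \<Rightarrow> 'h) \<Rightarrow> ('x \<Rightarrow> 'h) \<Rightarrow> 'x \<Rightarrow> 'x \<Rightarrow> complex"
  where "frame_kernel \<mu> \<nu> F G f g x y =
    cinner (g x) (f y) * cinner (canonical_dual \<mu> F f y) (canonical_dual \<nu> G g x)"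

definition localization_property ::
    "'x::metric_space measure \<Rightarrow> 'x measure \<Rightarrow> 'h::chilbert_space set \<Rightarrow> 'h set \<Rightarrow>
     ('x \<Rightarrow> 'h) \<Rightarrow> ('x \<Rightarrow> 'h) \<Rightarrow> bool"
  where "localization_property \<mu> \<nu> F G f g \<longleftrightarrow>
    (\<forall>\<epsilon>::real. \<epsilon> > 0 \<longrightarrow> (\<exists>R>0. \<forall>r\<ge>R. \<forall>a.
      ennreal (cmod (
        (LINT x:- ball a r|\<nu>. (LINT y:ball a r|\<mu>. frame_kernel \<mu> \<nu> F G f g x y)) -
        (LINT y:- ball a r|\<mu>. (LINT x:ball a r|\<nu>. frame_kernel \<mu> \<nu> F G f g x y))))
      < ennreal \<epsilon> * (emeasure \<mu> (ball a r) + emeasure \<nu> (ball a r))))"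

text \<open>Absolute convergence of the double integrals of the kernel over \<open>B \<times> X\<close> and \<open>X \<times> B\<close>, where
  \<open>B\<close> is a ball.  For measures that are finite on balls and concentrated on their supports, it
  holds for instance if both frames are norm bounded.  It is what justifies exchanging the order of
  integration.\<close>

definition kernel_integrable ::
    "'x::metric_space measure \<Rightarrow> 'x measure \<Rightarrow> 'h::chilbert_space set \<Rightarrow> 'h set \<Rightarrow>
     ('x \<Rightarrow> 'h) \<Rightarrow> ('x \<Rightarrow> 'h) \<Rightarrow> bool"
  where "kernel_integrable \<mu> \<nu> F G f g \<longleftrightarrow>
    (\<forall>a r. set_integrable (\<nu> \<Otimes>\<^sub>M \<mu>) (ball a r \<times> UNIV \<union> UNIV \<times> ball a r)
      (\<lambda>(x, y). frame_kernel \<mu> \<nu> F G f g x y))"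

end

theory Submission
  imports Defs
begin

text \<open>
  Integrating the kernel over all of \<open>X\<close> in one variable is, by the reconstruction formula of the
  frame in that variable, evaluation of the diagonal function \<open>\<langle>P\<^sub>G f~\<^sub>y, f\<^sub>y\<rangle>\<close> or
  \<open>\<langle>P\<^sub>F g\<^sub>x, g~\<^sub>x\<rangle>\<close>.  Hence the integrals of these two functions over a ball \<open>B\<close> are the integrals
  of the same kernel over \<open>X \<times> B\<close> and \<open>B \<times> X\<close>; the common part \<open>B \<times> B\<close> cancels in their
  difference, and what is left is the localization term, which is \<open>o(\<mu>(B) + \<nu>(B))\<close> uniformly in
  the center.  The bounds on the diagonal functions turn one of the two integrals into \<open>\<mu>(B)\<close> or
  \<open>\<nu>(B)\<close>.
\<close>

section \<open>Orthogonal projections\<close>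

text \<open>The solution is the minimizer of \<open>a u u - 2 * l u\<close>; a minimizing sequence is Cauchy by the
  parallelogram identity.\<close>

lemma symmetric_Lax_Milgram:
  fixes V :: "'a::{real_inner, complete_space} set" and a :: "'a \<Rightarrow> 'a \<Rightarrow> real"
  assumes V: "closed V" "subspace V"
    and sym: "\<And>x y. x \<in> V \<Longrightarrow> y \<in> V \<Longrightarrow> a x y = a y x"
    and add: "\<And>x y z. x \<in> V \<Longrightarrow> y \<in> V \<Longrightarrow> z \<in> V \<Longrightarrow> a (x + y) z = a x z + a y z"
    and scale: "\<And>r x y. x \<in> V \<Longrightarrow> y \<in> V \<Longrightarrow> a (r *\<^sub>R x) y = r * a x y"
    and bounded: "\<And>x y. x \<in> V \<Longrightarrow> y \<in> V \<Longrightarrow> \<bar>a x y\<bar> \<le> C * norm x * norm y"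
    and coercive: "0 < c" "\<And>x. x \<in> V \<Longrightarrow> c * (norm x)\<^sup>2 \<le> a x x"
    and ladd: "\<And>x y. x \<in> V \<Longrightarrow> y \<in> V \<Longrightarrow> l (x + y) = l x + l y"
    and lscale: "\<And>r x. x \<in> V \<Longrightarrow> l (r *\<^sub>R x) = r * l x"
    and lbounded: "\<And>x. x \<in> V \<Longrightarrow> \<bar>l x\<bar> \<le> K * norm x"
  obtains u where "u \<in> V" "\<And>v. v \<in> V \<Longrightarrow> a u v = l v"
proof -
  define J where "J u = a u u - 2 * l u" for u
  have V0 [simp]: "0 \<in> V" and Vadd [simp]: "\<And>x y. x \<in> V \<Longrightarrow> y \<in> V \<Longrightarrow> x + y \<in> V"
    and Vscale [simp]: "\<And>r x. x \<in> V \<Longrightarrow> r *\<^sub>R x \<in> V"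
    and Vdiff [simp]: "\<And>x y. x \<in> V \<Longrightarrow> y \<in> V \<Longrightarrow> x - y \<in> V"
    using V(2) by (auto simp: subspace_def subspace_diff)
  have add': "a z (x + y) = a z x + a z y" if "x \<in> V" "y \<in> V" "z \<in> V" for x y z
    using that add[of x y z] sym[of z] by simp
  have scale': "a y (r *\<^sub>R x) = r * a y x" if "x \<in> V" "y \<in> V" for r x y
    using that scale[of x y r] sym[of y] by simp
  have diff: "a (x - y) z = a x z - a y z" "a z (x - y) = a z x - a z y"
    if "x \<in> V" "y \<in> V" "z \<in> V" for x y z
  proof -
    have "x - y = x + (-1) *\<^sub>R y"
      by simp
    then show "a (x - y) z = a x z - a y z"
      using that add[of x "(-1) *\<^sub>R y" z] scale[of y z "-1"] Vscale[of y "-1"] by simp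
    then show "a z (x - y) = a z x - a z y"
      using that sym[of z] by simp
  qed
  have J_step: "J (u + t *\<^sub>R g) = J u + 2 * t * (a u g - l g) + t\<^sup>2 * a g g"
    if "u \<in> V" "g \<in> V" for u g t
    using that sym[of g u] unfolding J_def
    by (simp add: add add' scale scale' ladd lscale power2_eq_square algebra_simps)
  have parallelogram: "J u + J v = 2 * J ((1/2) *\<^sub>R (u + v)) + a (u - v) (u - v) / 2"
    if "u \<in> V" "v \<in> V" for u v
    using that sym[of v u] unfolding J_def
    by (simp add: add add' diff scale scale' ladd lscale field_simps)
  \<comment> \<open>Completing the square: the coercive quadratic term absorbs the linear one, so
    \<open>J\<close> has a finite infimum on \<open>V\<close>.\<close>
  have J_lower: "- (K\<^sup>2 / c) \<le> J u" if "u \<in> V" for u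
  proof -
    have "0 \<le> (c * norm u - K)\<^sup>2 / c"
      using coercive(1) by simp
    also have "\<dots> = c * (norm u)\<^sup>2 - 2 * (K * norm u) + K\<^sup>2 / c"
      using coercive(1) by (simp add: power2_eq_square field_simps)
    finally show ?thesis
      using coercive(2)[OF that] lbounded[OF that] unfolding J_def by linarith
  qed
  define m where "m = Inf (J ` V)"
  have bdd: "bdd_below (J ` V)"
    using J_lower by (auto intro!: bdd_belowI)
  have m_le: "m \<le> J u" if "u \<in> V" for u
    unfolding m_def using that bdd by (intro cInf_lower) auto
  have "\<exists>u\<in>V. J u < m + 1 / real (Suc n)" for n
  proof -
    have "Inf (J ` V) < m + 1 / real (Suc n)"
      unfolding m_def by simp
    then show ?thesis
      using V0 bdd by (subst (asm) cInf_less_iff) (auto simp del: V0)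
  qed
  then obtain u where uV [simp]: "\<And>n. u n \<in> V" and Ju: "\<And>n. J (u n) < m + 1 / real (Suc n)"
    by metis
  \<comment> \<open>The midpoint lies in \<open>V\<close>, so \<open>J\<close> is at least
    \<open>m\<close> there; the parallelogram identity then bounds the form at the difference by the
    two excesses of \<open>J\<close> over its infimum.\<close>
  have close: "(norm (u i - u j))\<^sup>2 \<le> (4 / c) * (1 / real (Suc N))" if "N \<le> i" "N \<le> j" for N i j
  proof -
    have "c * (norm (u i - u j))\<^sup>2 / 2 \<le> a (u i - u j) (u i - u j) / 2"
      using coercive(2)[of "u i - u j"] by simp
    also have "\<dots> \<le> (J (u i) - m) + (J (u j) - m)"
      using parallelogram[of "u i" "u j"] m_le[of "(1/2) *\<^sub>R (u i + u j)"] by simp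
    also have "\<dots> \<le> 1 / real (Suc i) + 1 / real (Suc j)"
      using Ju[of i] Ju[of j] by simp
    also have "\<dots> \<le> 1 / real (Suc N) + 1 / real (Suc N)"
      using that by (intro add_mono divide_left_mono) auto
    finally have "c * (norm (u i - u j))\<^sup>2 / 2 \<le> 1 / real (Suc N) + 1 / real (Suc N)" .
    moreover have "y \<le> (4 / c) * q" if "c * y / 2 \<le> q + q" for y q
      using that coercive(1) by (simp add: field_simps)
    ultimately show ?thesis
      by blast
  qed
  have "Cauchy u"
  proof (rule metric_CauchyI)
    fix e :: real
    assume e: "0 < e"
    have "(\<lambda>N. (4 / c) * (1 / real (Suc N))) \<longlonglongrightarrow> (4 / c) * 0"
      by (intro tendsto_intros LIMSEQ_Suc[OF lim_1_over_n])
    then have "\<forall>\<^sub>F N in sequentially. (4 / c) * (1 / real (Suc N)) < e\<^sup>2"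
      by (rule order_tendstoD(2)) (use e in simp)
    then obtain N where N: "(4 / c) * (1 / real (Suc N)) < e\<^sup>2"
      unfolding eventually_sequentially by blast
    show "\<exists>M. \<forall>i\<ge>M. \<forall>j\<ge>M. dist (u i) (u j) < e"
    proof (intro exI[of _ N] allI impI)
      fix i j
      assume "N \<le> i" "N \<le> j"
      then have "(norm (u i - u j))\<^sup>2 < e\<^sup>2"
        using close[of N i j] N by linarith
      then show "dist (u i) (u j) < e"
        using e by (simp add: dist_norm power_less_imp_less_base)
    qed
  qed
  then obtain w where w: "u \<longlonglongrightarrow> w"
    using Cauchy_convergent_iff convergent_def by blast
  have wV [simp]: "w \<in> V"
    using closed_sequentially[OF V(1) uV w] .
  have "a w g = l g" if g: "g \<in> V" for g
  proof -
    have "(\<lambda>n. a (u n) g - a w g) \<longlonglongrightarrow> 0"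
    proof (rule Lim_null_comparison)
      show "\<forall>\<^sub>F n in sequentially. norm (a (u n) g - a w g) \<le> C * norm (u n - w) * norm g"
        using bounded[of "u _ - w" g] g by (auto simp: diff)
      have "(\<lambda>n. C * norm (u n - w) * norm g) \<longlonglongrightarrow> C * 0 * norm g"
        using w by (intro tendsto_intros tendsto_norm_zero LIM_zero)
      then show "(\<lambda>n. C * norm (u n - w) * norm g) \<longlonglongrightarrow> 0"
        by simp
    qed
    then have lim: "(\<lambda>n. a (u n) g) \<longlonglongrightarrow> a w g"
      by (simp add: LIM_zero_iff)
    define d e where "d = a w g - l g" and "e = a g g"
    have e: "0 \<le> e"
      using coercive(2)[OF g] coercive(1) unfolding e_def
      by (meson order_trans zero_le_mult_iff zero_le_power2 less_imp_le)
    \<comment> \<open>First variation along \<open>g\<close>: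
      \<open>m \<le> J (u n + t *\<^sub>R g)\<close> and
      \<open>J (u n) < m + 1 / real (Suc n)\<close> bound the increment of \<open>J\<close> from
      below by \<open>- 1 / real (Suc n)\<close>. In the limit only the convergence of
      \<open>a (u n) g\<close> enters.\<close>
    have *: "0 \<le> 2 * t * d + t\<^sup>2 * e" for t
    proof (rule LIMSEQ_le_const)
      show "(\<lambda>n. 2 * t * (a (u n) g - l g) + t\<^sup>2 * e + 1 / real (Suc n)) \<longlonglongrightarrow> 2 * t * d + t\<^sup>2 * e"
        unfolding d_def
        by (rule tendsto_eq_intros lim LIMSEQ_Suc[OF lim_1_over_n] refl | simp)+
      show "\<exists>N. \<forall>n\<ge>N. 0 \<le> 2 * t * (a (u n) g - l g) + t\<^sup>2 * e + 1 / real (Suc n)"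
      proof (intro exI[of _ 0] allI impI)
        fix n
        show "0 \<le> 2 * t * (a (u n) g - l g) + t\<^sup>2 * e + 1 / real (Suc n)"
          using m_le[of "u n + t *\<^sub>R g"] J_step[of "u n" g t] Ju[of n] g unfolding e_def by simp
      qed
    qed
    \<comment> \<open>The quadratic in \<open>*\<close> is tested at minus this value. The natural
      choice would be \<open>d / e\<close>; adding 1 keeps the denominator positive when
      \<open>e = 0\<close>, and the quadratic still becomes negative unless
      \<open>d = 0\<close>.\<close>
    define t where "t = d / (e + 1)"
    have d: "d = t * (e + 1)"
      using e unfolding t_def by simp
    have "2 * (- t) * d + (- t)\<^sup>2 * e = - (t\<^sup>2 * (e + 2))"
      unfolding d by (simp add: power2_eq_square algebra_simps)
    with *[of "- t"] have "t\<^sup>2 * (e + 2) \<le> 0"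
      by simp
    then have "t = 0"
      using e by (simp add: mult_le_0_iff)
    with d have "d = 0"
      by simp
    then show ?thesis
      unfolding d_def by simp
  qed
  with wV that show thesis
    by blast
qed

section \<open>Passage from real to complex inner products\<close>

lemma cinner_scaleC_right: "cinner x (a *\<^sub>C y) = cnj a * cinner x (y::'h::chilbert_space)"
  by (metis cinner_commute cinner_scaleC_left complex_cnj_mult)

lemma cinner_diff_left: "cinner (x - y) z = cinner x z - cinner y (z::'h::chilbert_space)"
  by (metis add_diff_cancel cinner_add_left diff_add_cancel)

text \<open>The second premise compares imaginary parts. For forms that are conjugate linear in the
  second argument, these are the real parts of the values at \<open>\<i> *\<^sub>C g\<close>, so an
  identity of real parts on a complex subspace upgrades to the complex identity.\<close>

lemma complex_eqI_Re_rotate: "Re z = Re w \<Longrightarrow> Re (- (\<i> * z)) = Re (- (\<i> * w)) \<Longrightarrow> z = w"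
  by (simp add: complex_eq_iff)

lemma closed_csubspaceD:
  assumes "closed_csubspace F"
  shows "closed F" and "subspace F" and "\<And>a x. x \<in> F \<Longrightarrow> a *\<^sub>C x \<in> F"
proof -
  show "closed F" and C: "\<And>a x. x \<in> F \<Longrightarrow> a *\<^sub>C x \<in> F"
    using assms by (auto simp: closed_csubspace_def)
  show "subspace F"
    using assms C[of _ "of_real _"] by (auto simp: subspace_def closed_csubspace_def scaleC_of_real)
qed

text \<open>The projection represents the functional \<open>inner h\<close> on \<open>F\<close>, so
  it comes from \<open>symmetric_Lax_Milgram\<close> with the inner product as the form. It is
  unique because the difference of two candidates lies in \<open>F\<close> and is orthogonal to
  itself.\<close>

lemma orth_proj:
  assumes F: "closed_csubspace F"
  shows orth_proj_in: "orth_proj F h \<in> F"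
    and cinner_orth_proj_left: "g \<in> F \<Longrightarrow> cinner (orth_proj F h) g = cinner h g"
proof -
  note F' = closed_csubspaceD[OF F]
  obtain p where p: "p \<in> F" and inner: "\<And>g. g \<in> F \<Longrightarrow> inner p g = inner h g"
  proof (rule symmetric_Lax_Milgram[of F inner 1 1 "inner h" "norm h"])
    show "\<bar>x \<bullet> y\<bar> \<le> 1 * norm x * norm y" for x y :: 'a
      using Cauchy_Schwarz_ineq2[of x y] by simp
    show "\<bar>h \<bullet> x\<bar> \<le> norm h * norm x" for x
      by (rule Cauchy_Schwarz_ineq2)
  qed (use F' in \<open>auto simp: inner_commute inner_add_left inner_add_right power2_norm_eq_inner\<close>)
  have p_cinner: "cinner p g = cinner h g" if "g \<in> F" for g
    using inner[OF that] inner[OF F'(3)[OF that, of \<i>]]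
    by (intro complex_eqI_Re_rotate) (simp_all add: cinner_scaleC_right flip: Re_cinner)
  have "orth_proj F h = p"
    unfolding orth_proj_def
  proof (rule the_equality)
    show "p \<in> F \<and> (\<forall>g\<in>F. cinner (h - p) g = 0)"
      using p p_cinner by (simp add: cinner_diff_left)
    fix q
    assume q: "q \<in> F \<and> (\<forall>g\<in>F. cinner (h - q) g = 0)"
    then have "q - p \<in> F"
      using p F'(2) by (simp add: subspace_diff)
    then have "cinner (q - p) (q - p) = 0"
      using q p_cinner by (simp add: cinner_diff_left)
    then have "inner (q - p) (q - p) = 0"
      by (metis Re_cinner zero_complex.sel(1))
    then show "q = p"
      by simp
  qed
  then show "orth_proj F h \<in> F" "g \<in> F \<Longrightarrow> cinner (orth_proj F h) g = cinner h g"
    using p p_cinner by auto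
qed

lemma cinner_orth_proj_right:
  "closed_csubspace F \<Longrightarrow> g \<in> F \<Longrightarrow> cinner g (orth_proj F h) = cinner g h"
  by (metis cinner_commute cinner_orth_proj_left)

section \<open>Reconstruction from the canonical dual\<close>

text \<open>Removes the squares from the Cauchy-Schwarz inequality for nonnegative integrals, whose
  left side is not yet known to be finite.\<close>

lemma le_ennreal_of_power2_le:
  assumes "x\<^sup>2 \<le> (ennreal y)\<^sup>2" "0 \<le> y"
  shows "x \<le> ennreal y"
proof (cases x)
  case (real r)
  then show ?thesis
    using assms by (auto simp: ennreal_power intro!: ennreal_leI power2_le_imp_le)
next
  case top
  then show ?thesis
    using assms by (simp add: ennreal_power power2_eq_square top_unique flip: ennreal_mult)
qed

locale frame =
  fixes M :: "'x measure" and F :: "'h::chilbert_space set" and f :: "'x \<Rightarrow> 'h"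
  assumes closed_csubspace: "closed_csubspace F"
    and continuous_frame: "continuous_frame M F f"
begin

lemmas closed_F = closed_csubspaceD(1)[OF closed_csubspace]
  and subspace_F = closed_csubspaceD(2)[OF closed_csubspace]
  and scaleC_in_F [simp] = closed_csubspaceD(3)[OF closed_csubspace]

lemma add_in_F [simp]: "x \<in> F \<Longrightarrow> y \<in> F \<Longrightarrow> x + y \<in> F"
  and scaleR_in_F [simp]: "x \<in> F \<Longrightarrow> r *\<^sub>R x \<in> F"
  and diff_in_F [simp]: "x \<in> F \<Longrightarrow> y \<in> F \<Longrightarrow> x - y \<in> F"
  using subspace_F by (auto simp: subspace_add subspace_scale subspace_diff)

lemma f_in_F [simp]: "f x \<in> F"
  and measurable_coeff [measurable]: "h \<in> F \<Longrightarrow> (\<lambda>x. cinner h (f x)) \<in> borel_measurable M"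
  using continuous_frame by (auto simp: continuous_frame_def)

lemma measurable_coeff' [measurable]:
  assumes "h \<in> F"
  shows "(\<lambda>x. cinner (f x) h) \<in> borel_measurable M"
proof -
  have "(\<lambda>x. cnj (cinner h (f x))) \<in> borel_measurable M"
    using assms by (intro borel_measurable_continuous_on[OF _ measurable_coeff] continuous_intros)
  then show ?thesis
    by (simp flip: cinner_commute)
qed

text \<open>The form \<langle>Sh, g\<rangle> of the frame operator S, available before S is known to
  exist. Existence and surjectivity of S are read off from its boundedness, Hermitian symmetry and
  coercivity.\<close>

definition frame_form :: "'h \<Rightarrow> 'h \<Rightarrow> complex"
  where "frame_form h g = (LINT x|M. cinner h (f x) * cinner (f x) g)"

text \<open>Cauchy-Schwarz together with the upper frame bound. Stated for the nonnegative integral,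
  it yields both the integrability of the coefficient products and the boundedness of
  \<open>frame_form\<close>.\<close>

lemma nn_integral_coeffs_bounded:
  obtains C where "0 \<le> C"
    and "\<And>h g. h \<in> F \<Longrightarrow> g \<in> F \<Longrightarrow>
      (\<integral>\<^sup>+ x. ennreal (cmod (cinner h (f x) * cinner (f x) g)) \<partial>M) \<le> ennreal (C * norm h * norm g)"
proof -
  obtain c C :: real where C: "0 < c" "c \<le> C"
    and up: "\<And>h. h \<in> F \<Longrightarrow> (\<integral>\<^sup>+ x. ennreal ((cmod (cinner h (f x)))\<^sup>2) \<partial>M) \<le> ennreal (C * (norm h)\<^sup>2)"
    using continuous_frame unfolding continuous_frame_def by blast
  then have C: "0 \<le> C"
    by simp
  show thesis
  proof (rule that[OF C])
    fix h g
    assume hg [simp]: "h \<in> F" "g \<in> F"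
    let ?I = "\<integral>\<^sup>+ x. ennreal (cmod (cinner h (f x) * cinner (f x) g)) \<partial>M"
    have cmod_swap: "cmod (cinner (f x) g) = cmod (cinner g (f x))" for x
      by (metis cinner_commute complex_mod_cnj)
    have "?I\<^sup>2 = (\<integral>\<^sup>+ x. ennreal (cmod (cinner h (f x))) * ennreal (cmod (cinner g (f x))) \<partial>M)\<^sup>2"
      by (simp add: norm_mult ennreal_mult cmod_swap)
    also have "\<dots> \<le> (\<integral>\<^sup>+ x. ennreal (cmod (cinner h (f x)))^2 \<partial>M) * (\<integral>\<^sup>+ x. ennreal (cmod (cinner g (f x)))^2 \<partial>M)"
      by (rule Cauchy_Schwarz_nn_integral) measurable
    also have "\<dots> \<le> ennreal (C * (norm h)\<^sup>2) * ennreal (C * (norm g)\<^sup>2)"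
      using up[OF hg(1)] up[OF hg(2)] by (intro mult_mono) (auto simp: ennreal_power)
    also have "\<dots> = (ennreal (C * norm h * norm g))\<^sup>2"
      using C by (simp add: ennreal_power power2_eq_square mult_ac flip: ennreal_mult)
    finally have *: "?I\<^sup>2 \<le> (ennreal (C * norm h * norm g))\<^sup>2" .
    show "?I \<le> ennreal (C * norm h * norm g)"
      by (rule le_ennreal_of_power2_le[OF *]) (use C in simp)
  qed
qed

lemma integrable_coeffs:
  assumes [simp]: "h \<in> F" "g \<in> F"
  shows "integrable M (\<lambda>x. cinner h (f x) * cinner (f x) g)"
proof (rule integrableI_bounded)
  obtain C where "(\<integral>\<^sup>+ x. ennreal (cmod (cinner h (f x) * cinner (f x) g)) \<partial>M) \<le> ennreal (C * norm h * norm g)"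
    by (rule nn_integral_coeffs_bounded) (use assms in blast)
  then show "(\<integral>\<^sup>+ x. ennreal (cmod (cinner h (f x) * cinner (f x) g)) \<partial>M) < \<infinity>"
    by (rule le_less_trans) simp
qed measurable

lemma frame_form_bounded:
  obtains C where "\<And>h g. h \<in> F \<Longrightarrow> g \<in> F \<Longrightarrow> cmod (frame_form h g) \<le> C * norm h * norm g"
proof (rule nn_integral_coeffs_bounded)
  fix C :: real
  assume C: "0 \<le> C"
    and nn: "\<And>h g. h \<in> F \<Longrightarrow> g \<in> F \<Longrightarrow>
      (\<integral>\<^sup>+ x. ennreal (cmod (cinner h (f x) * cinner (f x) g)) \<partial>M) \<le> ennreal (C * norm h * norm g)"
  show thesis
  proof (rule that)
    fix h g
    assume hg: "h \<in> F" "g \<in> F"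
    have "ennreal (cmod (frame_form h g)) \<le> ennreal (C * norm h * norm g)"
      unfolding frame_form_def
      by (rule order_trans[OF integral_norm_bound_ennreal[OF integrable_coeffs[OF hg]] nn[OF hg]])
    then show "cmod (frame_form h g) \<le> C * norm h * norm g"
      using C by simp
  qed
qed

text \<open>On the diagonal the integrand is the squared modulus of the coefficient, so coercivity
  is the lower frame bound; integrability turns the nonnegative integral into the Bochner
  integral.\<close>

lemma frame_form_coercive:
  obtains c where "0 < c" and "\<And>h. h \<in> F \<Longrightarrow> c * (norm h)\<^sup>2 \<le> Re (frame_form h h)"
proof -
  obtain c :: real where c: "0 < c"
    and lo: "\<And>h. h \<in> F \<Longrightarrow> ennreal (c * (norm h)\<^sup>2) \<le> (\<integral>\<^sup>+ x. ennreal ((cmod (cinner h (f x)))\<^sup>2) \<partial>M)"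
    using continuous_frame unfolding continuous_frame_def by blast
  show thesis
  proof (rule that[OF c])
    fix h
    assume h: "h \<in> F"
    have sq: "cinner h (f x) * cinner (f x) h = of_real ((cmod (cinner h (f x)))\<^sup>2)" for x
      by (metis cinner_commute complex_norm_square)
    have "integrable M (\<lambda>x. complex_of_real ((cmod (cinner h (f x)))\<^sup>2))"
      using integrable_coeffs[OF h h] unfolding sq .
    then have int_sq: "integrable M (\<lambda>x. (cmod (cinner h (f x)))\<^sup>2)"
      by (rule iffD1[OF complex_of_real_integrable_eq])
    have "frame_form h h = of_real (LINT x|M. (cmod (cinner h (f x)))\<^sup>2)"
      unfolding frame_form_def sq by (rule integral_complex_of_real)
    then have Re: "Re (frame_form h h) = (LINT x|M. (cmod (cinner h (f x)))\<^sup>2)"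
      by simp
    have "ennreal (c * (norm h)\<^sup>2) \<le> ennreal (LINT x|M. (cmod (cinner h (f x)))\<^sup>2)"
      using lo[OF h] int_sq by (simp add: nn_integral_eq_integral)
    then show "c * (norm h)\<^sup>2 \<le> Re (frame_form h h)"
      unfolding Re by (subst (asm) ennreal_le_iff) auto
  qed
qed

section \<open>Hermitian symmetry and sesquilinearity of the frame form\<close>

lemma frame_form_commute: "frame_form h g = cnj (frame_form g h)"
proof -
  have "cinner h (f x) * cinner (f x) g = cnj (cinner g (f x) * cinner (f x) h)" for x
    by (metis cinner_commute complex_cnj_mult mult.commute)
  then show ?thesis
    unfolding frame_form_def by (simp only: Bochner_Integration.integral_cnj)
qed

lemma frame_form_add_left:
  "h \<in> F \<Longrightarrow> h' \<in> F \<Longrightarrow> g \<in> F \<Longrightarrow> frame_form (h + h') g = frame_form h g + frame_form h' g"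
  unfolding frame_form_def by (simp add: cinner_add_left distrib_right integrable_coeffs)

lemma frame_form_scaleC_left: "frame_form (a *\<^sub>C h) g = a * frame_form h g"
  unfolding frame_form_def by (simp add: cinner_scaleC_left mult.assoc)

lemma frame_form_scaleC_right: "frame_form h (a *\<^sub>C g) = cnj a * frame_form h g"
  by (metis frame_form_commute frame_form_scaleC_left complex_cnj_mult)

lemma frame_form_add_right:
  "h \<in> F \<Longrightarrow> g \<in> F \<Longrightarrow> g' \<in> F \<Longrightarrow> frame_form h (g + g') = frame_form h g + frame_form h g'"
  by (metis frame_form_commute frame_form_add_left complex_cnj_add)

lemma frame_form_scaleR:
  "frame_form (r *\<^sub>R h) g = of_real r * frame_form h g"
  "frame_form h (r *\<^sub>R g) = of_real r * frame_form h g"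
  using frame_form_scaleC_left[of "of_real r"] frame_form_scaleC_right[of _ "of_real r"]
  by (simp_all add: scaleC_of_real)

lemma cinner_ext:
  assumes "h \<in> F" "h' \<in> F" "\<And>g. g \<in> F \<Longrightarrow> cinner h g = cinner h' g"
  shows "h = h'"
proof -
  have "cinner (h - h') (h - h') = 0"
    using assms by (simp add: cinner_diff_left)
  then have "inner (h - h') (h - h') = 0"
    by (metis Re_cinner zero_complex.sel(1))
  then show ?thesis
    by simp
qed

text \<open>The weak integral denotes a vector by Riesz representation: the real part of
  \<open>frame_form h\<close> is a bounded real functional on \<open>F\<close>, represented via
  \<open>symmetric_Lax_Milgram\<close> with the inner product as the form.\<close>

lemma frame_op:
  assumes h: "h \<in> F"
  shows frame_op_in: "frame_op M F f h \<in> F"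
    and cinner_frame_op: "g \<in> F \<Longrightarrow> cinner (frame_op M F f h) g = frame_form h g"
proof -
  obtain C where bound: "\<And>h g. h \<in> F \<Longrightarrow> g \<in> F \<Longrightarrow> cmod (frame_form h g) \<le> C * norm h * norm g"
    using frame_form_bounded by blast
  obtain s where s: "s \<in> F" and inner: "\<And>g. g \<in> F \<Longrightarrow> inner s g = Re (frame_form h g)"
  proof (rule symmetric_Lax_Milgram[of F inner 1 1 "\<lambda>g. Re (frame_form h g)" "C * norm h"])
    show "\<bar>x \<bullet> y\<bar> \<le> 1 * norm x * norm y" for x y :: 'h
      using Cauchy_Schwarz_ineq2[of x y] by simp
    show "\<bar>Re (frame_form h x)\<bar> \<le> C * norm h * norm x" if "x \<in> F" for x
      by (rule order_trans[OF abs_Re_le_cmod bound[OF h that]])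
  qed (use h closed_F subspace_F in \<open>auto simp: inner_commute inner_add_left inner_add_right
      power2_norm_eq_inner frame_form_add_right frame_form_scaleR\<close>)
  have s_form: "cinner s g = frame_form h g" if "g \<in> F" for g
    using inner[OF that] inner[OF scaleC_in_F[OF that, of \<i>]]
    by (intro complex_eqI_Re_rotate)
      (simp_all add: cinner_scaleC_right frame_form_scaleC_right flip: Re_cinner)
  have "frame_op M F f h = s"
    unfolding frame_op_def
  proof (rule the_equality)
    show "s \<in> F \<and> (\<forall>g\<in>F. cinner s g = (LINT x|M. cinner h (f x) * cinner (f x) g))"
      using s s_form by (simp add: frame_form_def)
    show "q = s" if "q \<in> F \<and> (\<forall>g\<in>F. cinner q g = (LINT x|M. cinner h (f x) * cinner (f x) g))" for q
      using that s s_form by (intro cinner_ext) (auto simp: frame_form_def)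
  qed
  then show "frame_op M F f h \<in> F" "g \<in> F \<Longrightarrow> cinner (frame_op M F f h) g = frame_form h g"
    using s s_form by auto
qed

text \<open>Now the real part of the frame form is itself the coercive form in
  \<open>symmetric_Lax_Milgram\<close>, and \<open>inner h\<close> is the functional. Surjectivity
  makes the \<open>inv_into\<close> in \<open>canonical_dual\<close> a genuine preimage under the
  frame operator.\<close>

lemma frame_op_surj:
  assumes h: "h \<in> F"
  shows "h \<in> frame_op M F f ` F"
proof -
  obtain c where c: "0 < c"
    and coercive: "\<And>h. h \<in> F \<Longrightarrow> c * (norm h)\<^sup>2 \<le> Re (frame_form h h)"
    using frame_form_coercive by blast
  obtain C where bound: "\<And>h g. h \<in> F \<Longrightarrow> g \<in> F \<Longrightarrow> cmod (frame_form h g) \<le> C * norm h * norm g"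
    using frame_form_bounded by blast
  obtain s where s: "s \<in> F" and Re: "\<And>g. g \<in> F \<Longrightarrow> Re (frame_form s g) = inner h g"
  proof (rule symmetric_Lax_Milgram[of F "\<lambda>s g. Re (frame_form s g)" C c "inner h" "norm h"])
    show "Re (frame_form x y) = Re (frame_form y x)" for x y
      by (subst frame_form_commute) simp
    show "\<bar>Re (frame_form x y)\<bar> \<le> C * norm x * norm y" if "x \<in> F" "y \<in> F" for x y
      by (rule order_trans[OF abs_Re_le_cmod bound[OF that]])
    show "\<bar>h \<bullet> x\<bar> \<le> norm h * norm x" for x
      by (rule Cauchy_Schwarz_ineq2)
  qed (use c coercive closed_F subspace_F in \<open>auto simp: inner_add_right
      frame_form_add_left frame_form_scaleR\<close>)
  have "frame_form s g = cinner h g" if "g \<in> F" for g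
    using Re[OF that] Re[OF scaleC_in_F[OF that, of \<i>]]
    by (intro complex_eqI_Re_rotate)
      (simp_all add: cinner_scaleC_right frame_form_scaleC_right flip: Re_cinner)
  then have "h = frame_op M F f s"
    using h s by (intro cinner_ext) (simp_all add: frame_op_in cinner_frame_op)
  with s show ?thesis
    by blast
qed

section \<open>The canonical dual and the reconstruction formula\<close>

lemma canonical_dual_in: "canonical_dual M F f x \<in> F"
  unfolding canonical_dual_def by (intro inv_into_into frame_op_surj f_in_F)

lemma frame_op_canonical_dual: "frame_op M F f (canonical_dual M F f x) = f x"
  unfolding canonical_dual_def by (intro f_inv_into_f frame_op_surj f_in_F)

text \<open>Write k = Sw. Self-adjointness of S gives \<langle>S^{-1} f_x, Sw\<rangle> =
  \<langle>f_x, w\<rangle>, so the integral is \<open>frame_form h w\<close>, which equals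
  \<langle>h, Sw\<rangle>.\<close>

lemma reconstruction:
  assumes h: "h \<in> F" and k: "k \<in> F"
  shows "(LINT x|M. cinner h (f x) * cinner (canonical_dual M F f x) k) = cinner h k"
proof -
  obtain w where w: "w \<in> F" "k = frame_op M F f w"
    using frame_op_surj[OF k] by blast
  have adjoint: "cinner u (frame_op M F f w) = frame_form u w" if "u \<in> F" for u
    by (subst cinner_commute) (simp add: cinner_frame_op that w(1) flip: frame_form_commute)
  have "cinner (canonical_dual M F f x) k = cinner (f x) w" for x
    using cinner_frame_op[OF canonical_dual_in w(1), of x]
    by (simp add: w(2) adjoint canonical_dual_in frame_op_canonical_dual)
  then show ?thesis
    using adjoint[OF h] by (simp add: frame_form_def w(2))
qed

text \<open>The conjugate form, with the dual in the second slot: this is how the \<nu>-variable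
  occurs in \<open>frame_kernel\<close>.\<close>

lemma reconstruction':
  assumes h: "h \<in> F" and k: "k \<in> F"
  shows "(LINT x|M. cinner (f x) h * cinner k (canonical_dual M F f x)) = cinner k h"
proof -
  have "cinner (f x) h * cinner k (canonical_dual M F f x) =
      cnj (cinner h (f x) * cinner (canonical_dual M F f x) k)" for x
    by (metis cinner_commute complex_cnj_mult)
  then have "(LINT x|M. cinner (f x) h * cinner k (canonical_dual M F f x)) = cnj (cinner h k)"
    by (simp only: Bochner_Integration.integral_cnj reconstruction[OF h k])
  then show ?thesis
    by (metis cinner_commute)
qed

end

lemma integral_frame_kernel:
  assumes "closed_csubspace F" "closed_csubspace G"
    and "continuous_frame \<mu> F f" "continuous_frame \<nu> G g"
  shows integral_frame_kernel_fst: "(LINT x|\<nu>. frame_kernel \<mu> \<nu> F G f g x y) =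
      cinner (orth_proj G (canonical_dual \<mu> F f y)) (f y)"
    and integral_frame_kernel_snd: "(LINT y|\<mu>. frame_kernel \<mu> \<nu> F G f g x y) =
      cinner (orth_proj F (g x)) (canonical_dual \<nu> G g x)"
proof -
  interpret f: frame \<mu> F f
    using assms by unfold_locales
  interpret g: frame \<nu> G g
    using assms by unfold_locales
  have "frame_kernel \<mu> \<nu> F G f g x y = cinner (g x) (orth_proj G (f y)) *
      cinner (orth_proj G (canonical_dual \<mu> F f y)) (canonical_dual \<nu> G g x)" for x
    by (simp add: frame_kernel_def cinner_orth_proj_left cinner_orth_proj_right
        assms g.canonical_dual_in)
  then have "(LINT x|\<nu>. frame_kernel \<mu> \<nu> F G f g x y) =
      cinner (orth_proj G (canonical_dual \<mu> F f y)) (orth_proj G (f y))"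
    by (simp add: g.reconstruction' orth_proj_in assms)
  then show "(LINT x|\<nu>. frame_kernel \<mu> \<nu> F G f g x y) =
      cinner (orth_proj G (canonical_dual \<mu> F f y)) (f y)"
    by (simp add: orth_proj_in cinner_orth_proj_right assms)
  have "frame_kernel \<mu> \<nu> F G f g x y = cinner (orth_proj F (g x)) (f y) *
      cinner (canonical_dual \<mu> F f y) (orth_proj F (canonical_dual \<nu> G g x))" for y
    by (simp add: frame_kernel_def cinner_orth_proj_left cinner_orth_proj_right
        assms f.canonical_dual_in)
  then have "(LINT y|\<mu>. frame_kernel \<mu> \<nu> F G f g x y) =
      cinner (orth_proj F (g x)) (orth_proj F (canonical_dual \<nu> G g x))"
    by (simp add: f.reconstruction orth_proj_in assms)
  then show "(LINT y|\<mu>. frame_kernel \<mu> \<nu> F G f g x y) =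
      cinner (orth_proj F (g x)) (canonical_dual \<nu> G g x)"
    by (simp add: orth_proj_in cinner_orth_proj_right assms)
qed

section \<open>Double integrals over products\<close>

text \<open>Fubini for the kernel cut off outside a rectangle: the indicator of the rectangle is a
  product, so one factor leaves the inner integral and the other turns it into a set
  integral.\<close>

lemma (in pair_sigma_finite)
  fixes k :: "'a \<Rightarrow> 'b \<Rightarrow> 'c::{banach, second_countable_topology}"
  assumes k: "set_integrable (M1 \<Otimes>\<^sub>M M2) (A \<times> B) (\<lambda>(x, y). k x y)"
  shows set_integrable_fst: "set_integrable M1 A (\<lambda>x. LINT y:B|M2. k x y)"
    and set_integral_fst:
      "(LINT x:A|M1. LINT y:B|M2. k x y) = (LINT z:A \<times> B|M1 \<Otimes>\<^sub>M M2. case z of (x, y) \<Rightarrow> k x y)"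
    and set_integrable_snd: "set_integrable M2 B (\<lambda>y. LINT x:A|M1. k x y)"
    and set_integral_snd:
      "(LINT y:B|M2. LINT x:A|M1. k x y) = (LINT z:A \<times> B|M1 \<Otimes>\<^sub>M M2. case z of (x, y) \<Rightarrow> k x y)"
proof -
  let ?h = "\<lambda>x y. indicator (A \<times> B) (x, y) *\<^sub>R k x y"
  have h: "integrable (M1 \<Otimes>\<^sub>M M2) (case_prod ?h)"
    using k by (simp add: set_integrable_def case_prod_unfold)
  have int: "(LINT z:A \<times> B|M1 \<Otimes>\<^sub>M M2. case z of (x, y) \<Rightarrow> k x y) = integral\<^sup>L (M1 \<Otimes>\<^sub>M M2) (case_prod ?h)"
    by (simp add: set_lebesgue_integral_def case_prod_unfold)
  have fst: "(LINT y|M2. ?h x y) = indicator A x *\<^sub>R (LINT y:B|M2. k x y)" for x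
    by (simp add: set_lebesgue_integral_def indicator_times flip: scaleR_scaleR)
  have snd: "(LINT x|M1. ?h x y) = indicator B y *\<^sub>R (LINT x:A|M1. k x y)" for y
    by (simp add: set_lebesgue_integral_def indicator_times mult.commute[of "indicator A _"]
        flip: scaleR_scaleR)
  show "set_integrable M1 A (\<lambda>x. LINT y:B|M2. k x y)"
    using integrable_fst[OF h] unfolding fst set_integrable_def .
  show "(LINT x:A|M1. LINT y:B|M2. k x y) = (LINT z:A \<times> B|M1 \<Otimes>\<^sub>M M2. case z of (x, y) \<Rightarrow> k x y)"
    using integral_fst[OF h] unfolding fst int by (simp add: set_lebesgue_integral_def)
  show "set_integrable M2 B (\<lambda>y. LINT x:A|M1. k x y)"
    using integrable_snd[OF h] unfolding snd set_integrable_def .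
  show "(LINT y:B|M2. LINT x:A|M1. k x y) = (LINT z:A \<times> B|M1 \<Otimes>\<^sub>M M2. case z of (x, y) \<Rightarrow> k x y)"
    using integral_snd[OF h] unfolding snd int by (simp add: set_lebesgue_integral_def)
qed

text \<open>The left side is a difference of integrals over two strips that cross in
  \<open>A \<times> B\<close>. Absolute integrability on the cross makes the order of integration
  irrelevant there, so the common rectangle cancels.\<close>

lemma (in pair_sigma_finite) set_integral_difference_Fubini:
  fixes k :: "'a \<Rightarrow> 'b \<Rightarrow> 'c::{banach, second_countable_topology}"
  assumes k: "set_integrable (M1 \<Otimes>\<^sub>M M2) (A \<times> space M2 \<union> space M1 \<times> B) (\<lambda>(x, y). k x y)"
    and A: "A \<in> sets M1" and B: "B \<in> sets M2"
  shows "set_integrable M2 B (\<lambda>y. LINT x|M1. k x y)"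
    and "set_integrable M1 A (\<lambda>x. LINT y|M2. k x y)"
    and "(LINT y:B|M2. LINT x|M1. k x y) - (LINT x:A|M1. LINT y|M2. k x y) =
      (LINT x:space M1 - A|M1. LINT y:B|M2. k x y) - (LINT y:space M2 - B|M2. LINT x:A|M1. k x y)"
proof -
  let ?k = "\<lambda>(x, y). k x y" and ?P = "M1 \<Otimes>\<^sub>M M2"
  have int: "set_integrable ?P S ?k" if "S \<in> sets ?P" "S \<subseteq> A \<times> space M2 \<union> space M1 \<times> B" for S
    using k that by (rule set_integrable_subset)
  note sub = sets.sets_into_space[OF A] sets.sets_into_space[OF B]
  have int': "set_integrable ?P (A \<times> B) ?k" "set_integrable ?P ((space M1 - A) \<times> B) ?k"
    "set_integrable ?P (A \<times> (space M2 - B)) ?k"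
    "set_integrable ?P (space M1 \<times> B) ?k" "set_integrable ?P (A \<times> space M2) ?k"
    using sub A B by (auto intro!: int)
  \<comment> \<open>Full integrals become set integrals over the space, so that the strips are
    rectangles covered by the previous lemma.\<close>
  have space_int: "(LINT x|M1. k x y) = (LINT x:space M1|M1. k x y)"
    "(LINT y|M2. k x y) = (LINT y:space M2|M2. k x y)" for x y
    unfolding set_lebesgue_integral_def by (auto intro!: Bochner_Integration.integral_cong)
  show "set_integrable M2 B (\<lambda>y. LINT x|M1. k x y)"
    unfolding space_int by (rule set_integrable_snd[OF int'(4)])
  show "set_integrable M1 A (\<lambda>x. LINT y|M2. k x y)"
    unfolding space_int by (rule set_integrable_fst[OF int'(5)])
  have "space M1 \<times> B = A \<times> B \<union> (space M1 - A) \<times> B"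
    using sub by auto
  then have "(LINT z:space M1 \<times> B|?P. ?k z) = (LINT z:A \<times> B|?P. ?k z) + (LINT z:(space M1 - A) \<times> B|?P. ?k z)"
    using int'(1,2) by (simp only:) (rule set_integral_Un, auto)
  moreover have "A \<times> space M2 = A \<times> B \<union> A \<times> (space M2 - B)"
    using sub by auto
  then have "(LINT z:A \<times> space M2|?P. ?k z) = (LINT z:A \<times> B|?P. ?k z) + (LINT z:A \<times> (space M2 - B)|?P. ?k z)"
    using int'(1,3) by (simp only:) (rule set_integral_Un, auto)
  ultimately show "(LINT y:B|M2. LINT x|M1. k x y) - (LINT x:A|M1. LINT y|M2. k x y) =
      (LINT x:space M1 - A|M1. LINT y:B|M2. k x y) - (LINT y:space M2 - B|M2. LINT x:A|M1. k x y)"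
    by (simp add: space_int set_integral_fst set_integral_snd int')
qed

section \<open>Measures of balls and densities\<close>

lemma norm_set_integral_le_measure:
  fixes f :: "'a \<Rightarrow> 'b::{banach, second_countable_topology}"
  assumes f: "set_integrable M A f"
    and A: "A \<in> sets M" "emeasure M A < \<infinity>"
    and le: "AE x in M. norm (f x) \<le> 1"
  shows "norm (LINT x:A|M. f x) \<le> measure M A"
proof -
  have "norm (LINT x:A|M. f x) \<le> (LINT x|M. norm (indicator A x *\<^sub>R f x))"
    unfolding set_lebesgue_integral_def by (rule integral_norm_bound)
  also have "\<dots> \<le> (LINT x|M. indicator A x)"
  proof (rule integral_mono_AE)
    show "AE x in M. norm (indicator A x *\<^sub>R f x) \<le> indicator A x"
      using le by eventually_elim (auto simp: indicator_def)
    show "integrable M (\<lambda>x. norm (indicator A x *\<^sub>R f x))"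
      using f unfolding set_integrable_def by (rule integrable_norm)
  qed (use A in auto)
  also have "\<dots> = measure M A"
    using A sets.sets_into_space[OF A(1)] by (simp add: Int_absorb2)
  finally show ?thesis .
qed

lemma measure_le_cmod_set_integral:
  assumes f: "set_integrable M A f"
    and A: "A \<in> sets M" "emeasure M A < \<infinity>"
    and ge: "AE x in M. 1 \<le> Re (f x)"
  shows "measure M A \<le> cmod (LINT x:A|M. f x)"
proof -
  have "measure M A = (LINT x|M. indicator A x)"
    using A sets.sets_into_space[OF A(1)] by (simp add: Int_absorb2)
  also have "\<dots> \<le> (LINT x|M. Re (indicator A x *\<^sub>R f x))"
  proof (rule integral_mono_AE)
    show "AE x in M. indicator A x \<le> Re (indicator A x *\<^sub>R f x)"
      using ge by eventually_elim (auto simp: indicator_def)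
    show "integrable M (\<lambda>x. Re (indicator A x *\<^sub>R f x))"
      using f unfolding set_integrable_def by (rule integrable_Re)
  qed (use A in auto)
  also have "\<dots> = Re (LINT x:A|M. f x)"
    using f unfolding set_integrable_def set_lebesgue_integral_def by (rule integral_Re)
  also have "\<dots> \<le> cmod (LINT x:A|M. f x)"
    by (rule complex_Re_le_cmod)
  finally show ?thesis .
qed

section \<open>Supports, sigma-finiteness and positivity of large balls\<close>

lemma closed_measure_support: "closed (measure_support M)"
proof -
  have "- measure_support M = \<Union>{U. open U \<and> emeasure M U = 0}"
    by (auto simp: measure_support_def not_gr_zero)
  then show ?thesis
    by (auto simp: closed_def)
qed

text \<open>The bounds on the diagonal functions are given only on the supports; this turns them
  into almost everywhere bounds.\<close>

lemma AE_on_measure_support: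
  assumes "sets M = sets borel" "emeasure M (- measure_support M) = 0"
    and "\<And>x. x \<in> measure_support M \<Longrightarrow> P x"
  shows "AE x in M. P x"
proof (rule AE_I)
  show "{x \<in> space M. \<not> P x} \<subseteq> - measure_support M"
    using assms(3) by auto
  show "- measure_support M \<in> sets M"
    unfolding assms(1) using closed_measure_support[of M] by (intro borel_open open_Compl)
qed fact

lemma finite_on_balls_sigma_finite:
  fixes M :: "'a::metric_space measure"
  assumes "sets M = sets borel" "finite_on_balls M"
  shows "sigma_finite_measure M"
proof
  fix a :: 'a
  have "(\<Union>n. ball a (real n)) = UNIV"
    using reals_Archimedean2 by auto
  moreover have "space M = UNIV"
    using sets_eq_imp_space_eq[OF assms(1)] by simp
  ultimately show "\<exists>A. countable A \<and> A \<subseteq> sets M \<and> \<Union>A = space M \<and> (\<forall>a\<in>A. emeasure M a \<noteq> \<infinity>)"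
    using assms by (intro exI[of _ "range (\<lambda>n. ball a (real n))"])
      (auto simp: finite_on_balls_def less_top)
qed

lemma large_balls_positive_eventually:
  assumes M: "sets M = sets borel" "finite_on_balls M" and "large_balls_positive M"
  shows "\<forall>\<^sub>F r in at_top. \<forall>a. 0 < measure M (ball a r)"
proof -
  obtain R where R: "\<And>a. 0 < emeasure M (ball a R)"
    using assms(3) by (auto simp: large_balls_positive_def)
  show ?thesis
    using eventually_ge_at_top[of R]
  proof eventually_elim
    case (elim r)
    have "0 < emeasure M (ball a r)" for a
      using elim M(1) by (intro less_le_trans[OF R[of a]] emeasure_mono) auto
    moreover have "emeasure M (ball a r) \<noteq> \<infinity>" for a
      using M(2) by (metis finite_on_balls_def less_irrefl)
    ultimately show ?case
      by (metis emeasure_eq_ennreal_measure ennreal_less_zero_iff infinity_ennreal_def)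
  qed
qed

text \<open>The error term contains \<open>p\<close>, \<open>q\<close> and \<open>m\<close> so that
  one statement serves both comparisons: the reference measure is \<open>m\<close>, while the other
  measure is \<open>q\<close> in (i) and \<open>p\<close> in (ii). Limits may be infinite, so they
  are compared through finite levels \<open>d < e\<close> instead of by subtraction.\<close>

lemma ratio_bounds_transfer:
  fixes p q m :: "real \<Rightarrow> 'a \<Rightarrow> real"
  assumes pos: "\<forall>\<^sub>F r in at_top. \<forall>a. 0 < m r a"
    and nonneg: "\<And>r a. 0 \<le> p r a" "\<And>r a. 0 \<le> q r a"
    and close: "\<And>\<epsilon>. 0 < \<epsilon> \<Longrightarrow> \<forall>\<^sub>F r in at_top. \<forall>a. p r a \<le> q r a + \<epsilon> * (m r a + p r a + q r a)"
  shows "Liminf at_top (\<lambda>r. INF a. ennreal (p r a) / ennreal (m r a))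
           \<le> Liminf at_top (\<lambda>r. INF a. ennreal (q r a) / ennreal (m r a))" (is "?Lp \<le> ?Lq")
    and "Limsup at_top (\<lambda>r. SUP a. ennreal (p r a) / ennreal (m r a))
           \<le> Limsup at_top (\<lambda>r. SUP a. ennreal (q r a) / ennreal (m r a))" (is "?Up \<le> ?Uq")
proof -
  have key: "\<forall>\<^sub>F r in at_top. \<forall>a.
      ennreal (q r a) / ennreal (m r a) < ennreal d \<longrightarrow> ennreal (p r a) / ennreal (m r a) \<le> ennreal e"
    if "0 \<le> d" "d < e" for d e :: real
  proof -
    \<comment> \<open>The solution of
      \<open>d + \<epsilon> * (1 + d) = e * (1 - \<epsilon>)\<close>: with this error,
      \<open>q \<le> d * m\<close> gives exactly \<open>p \<le> e * m\<close> after dividing by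
      \<open>1 - \<epsilon>\<close>.\<close>
    define \<epsilon> where "\<epsilon> = (e - d) / (1 + d + e)"
    have \<epsilon>: "0 < \<epsilon>" "\<epsilon> < 1" "d + \<epsilon> * (1 + d) = e * (1 - \<epsilon>)"
      using that unfolding \<epsilon>_def by (auto simp: field_simps)
    show ?thesis
      using pos close[OF \<epsilon>(1)]
    proof eventually_elim
      case (elim r)
      show ?case
      proof (intro allI impI)
        fix a
        assume "ennreal (q r a) / ennreal (m r a) < ennreal d"
        then have q: "q r a \<le> d * m r a"
          using elim(1) nonneg by (auto simp: divide_ennreal ennreal_less_iff field_simps less_imp_le)
        have "p r a * (1 - \<epsilon>) \<le> q r a * (1 + \<epsilon>) + \<epsilon> * m r a"
          using elim(2) by (simp add: algebra_simps)
        also have "\<dots> \<le> d * m r a * (1 + \<epsilon>) + \<epsilon> * m r a"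
          using q \<epsilon> by (simp add: mult_right_mono)
        also have "\<dots> = m r a * (d + \<epsilon> * (1 + d))"
          by (simp add: algebra_simps)
        also have "\<dots> = (e * m r a) * (1 - \<epsilon>)"
          using \<epsilon>(3) by simp
        finally have "p r a \<le> e * m r a"
          using \<epsilon>(2) by simp
        then show "ennreal (p r a) / ennreal (m r a) \<le> ennreal e"
          using elim(1) nonneg by (auto simp: divide_ennreal field_simps intro!: ennreal_leI)
      qed
    qed
  qed
  \<comment> \<open>Density is used twice to get two levels; both are finite because they lie
    strictly below another value.\<close>
  have between: "\<exists>d e. 0 \<le> d \<and> d < e \<and> x < ennreal d \<and> ennreal e < y" if xy: "x < y" for x y :: ennreal
  proof -
    obtain s where s: "x < s" "s < y"
      using dense[OF xy] by blast
    obtain t where t: "s < t" "t < y"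
      using dense[OF s(2)] by blast
    have "s < top" "t < top"
      using t by (auto intro: less_le_trans[OF _ top_greatest])
    then show ?thesis
      using s t by (cases s; cases t) (auto simp: ennreal_less_iff)
  qed
  show "?Lp \<le> ?Lq"
  proof (rule ccontr)
    assume "\<not> ?thesis"
    then obtain d e where de: "0 \<le> d" "d < e" "?Lq < ennreal d" "ennreal e < ?Lp"
      using between[of ?Lq ?Lp] by (auto simp: not_le)
    \<comment> \<open>\<open>key\<close> in contrapositive form: eventually all quotients of
      \<open>p\<close> exceed \<open>e\<close>, so all quotients of \<open>q\<close> are at least
      \<open>d\<close>.\<close>
    have "ennreal d \<le> ?Lq"
    proof (rule Liminf_bounded)
      show "\<forall>\<^sub>F r in at_top. ennreal d \<le> (INF a. ennreal (q r a) / ennreal (m r a))"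
        using key[OF de(1,2)] less_LiminfD[OF de(4)]
      proof eventually_elim
        case (elim r)
        show ?case
        proof (rule INF_greatest, rule ccontr)
          fix a
          assume "\<not> ennreal d \<le> ennreal (q r a) / ennreal (m r a)"
          then have "ennreal (p r a) / ennreal (m r a) \<le> ennreal e"
            using elim(1) by auto
          moreover have "ennreal e < ennreal (p r a) / ennreal (m r a)"
            using elim(2) by (rule less_le_trans) (rule INF_lower, simp)
          ultimately show False
            by simp
        qed
      qed
    qed
    with de(3) show False
      by simp
  qed
  show "?Up \<le> ?Uq"
  proof (rule ccontr)
    assume "\<not> ?thesis"
    then obtain d e where de: "0 \<le> d" "d < e" "?Uq < ennreal d" "ennreal e < ?Up"
      using between[of ?Uq ?Up] by (auto simp: not_le)
    \<comment> \<open>\<open>key\<close> directly: eventually all quotients of \<open>q\<close> are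
      below \<open>d\<close>, so all quotients of \<open>p\<close> are at most
      \<open>e\<close>.\<close>
    have "?Up \<le> ennreal e"
    proof (rule Limsup_bounded)
      show "\<forall>\<^sub>F r in at_top. (SUP a. ennreal (p r a) / ennreal (m r a)) \<le> ennreal e"
        using key[OF de(1,2)] Limsup_lessD[OF de(3)]
      proof eventually_elim
        case (elim r)
        show ?case
        proof (rule SUP_least)
          fix a
          have "ennreal (q r a) / ennreal (m r a) < ennreal d"
            using elim(2) by (rule le_less_trans[rotated]) (rule SUP_upper, simp)
          then show "ennreal (p r a) / ennreal (m r a) \<le> ennreal e"
            using elim(1) by auto
        qed
      qed
    qed
    with de(4) show False
      by simp
  qed
qed

section \<open>Comparison of the densities of the two frames\<close>

theorem theorem3p2:
  fixes \<mu> \<nu> :: "'x::metric_space measure"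
    and F G :: "'h::chilbert_space set"
    and f g :: "'x \<Rightarrow> 'h"
  assumes "closed_csubspace F" and "closed_csubspace G"
    and "sets \<mu> = sets borel" and "sets \<nu> = sets borel"
    and "finite_on_balls \<mu>" and "finite_on_balls \<nu>"
    and "large_balls_positive \<mu>" and "large_balls_positive \<nu>"
    and "emeasure \<mu> (- measure_support \<mu>) = 0" and "emeasure \<nu> (- measure_support \<nu>) = 0"
    and "continuous_frame \<mu> F f" and "continuous_frame \<nu> G g"
    and "kernel_integrable \<mu> \<nu> F G f g"
    and "localization_property \<mu> \<nu> F G f g"
  shows
    "((\<forall>x\<in>measure_support \<nu>. cmod (cinner (orth_proj F (g x)) (canonical_dual \<nu> G g x)) \<le> 1)
      \<longrightarrow> lower_density \<mu> \<nu>
            \<ge> lower_ball_average \<mu> (\<lambda>y. cinner (orth_proj G (canonical_dual \<mu> F f y)) (f y)) \<and>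
          upper_density \<mu> \<nu>
            \<ge> upper_ball_average \<mu> (\<lambda>y. cinner (orth_proj G (canonical_dual \<mu> F f y)) (f y)))
     \<and>
     ((\<forall>y\<in>measure_support \<mu>.
          cinner (orth_proj G (canonical_dual \<mu> F f y)) (f y) \<in> \<real> \<and>
          Re (cinner (orth_proj G (canonical_dual \<mu> F f y)) (f y)) \<ge> 1)
      \<longrightarrow> upper_density \<nu> \<mu>
            \<le> upper_ball_average \<nu> (\<lambda>x. cinner (orth_proj F (g x)) (canonical_dual \<nu> G g x)) \<and>
          lower_density \<nu> \<mu>
            \<le> lower_ball_average \<nu> (\<lambda>x. cinner (orth_proj F (g x)) (canonical_dual \<nu> G g x)))
     \<and>
     ((\<forall>x\<in>measure_support \<nu>. cmod (cinner (orth_proj F (g x)) (canonical_dual \<nu> G g x)) \<le> 1) \<and>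
      (\<forall>y\<in>measure_support \<mu>.
          cinner (orth_proj G (canonical_dual \<mu> F f y)) (f y) \<in> \<real> \<and>
          Re (cinner (orth_proj G (canonical_dual \<mu> F f y)) (f y)) \<ge> 1)
      \<longrightarrow> lower_density \<mu> \<nu> \<ge> 1 \<and> upper_density \<nu> \<mu> \<le> 1)"
proof -
  define \<phi> where "\<phi> y = cinner (orth_proj G (canonical_dual \<mu> F f y)) (f y)" for y
  define \<psi> where "\<psi> x = cinner (orth_proj F (g x)) (canonical_dual \<nu> G g x)" for x
  interpret \<mu>: sigma_finite_measure \<mu>
    using assms by (intro finite_on_balls_sigma_finite)
  interpret \<nu>: sigma_finite_measure \<nu>
    using assms by (intro finite_on_balls_sigma_finite)
  interpret pair_sigma_finite \<nu> \<mu> ..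
  have ball_sets: "ball a r \<in> sets \<mu>" "ball a r \<in> sets \<nu>" for a r
    using assms(3,4) by auto
  have spaces: "space \<mu> = UNIV" "space \<nu> = UNIV"
    using assms(3,4) by (auto dest: sets_eq_imp_space_eq)
  have ball_fin: "emeasure \<mu> (ball a r) < \<infinity>" "emeasure \<nu> (ball a r) < \<infinity>" for a r
    using assms(5,6) by (auto simp: finite_on_balls_def)
  have em: "emeasure \<mu> (ball a r) = ennreal (measure \<mu> (ball a r))"
    "emeasure \<nu> (ball a r) = ennreal (measure \<nu> (ball a r))" for a r
    using ball_fin[of a r] by (simp_all add: emeasure_eq_ennreal_measure less_top)
  \<comment> \<open>Both sets are the same ball, with \<nu> as first and \<mu> as second factor. The
    full inner integrals collapse to \<open>\<phi>\<close> and \<open>\<psi>\<close>, and the right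
    side is exactly the expression in the localization property.\<close>
  have Fubini: "set_integrable \<mu> (ball a r) \<phi>" "set_integrable \<nu> (ball a r) \<psi>"
    "(LINT y:ball a r|\<mu>. \<phi> y) - (LINT x:ball a r|\<nu>. \<psi> x) =
      (LINT x:- ball a r|\<nu>. (LINT y:ball a r|\<mu>. frame_kernel \<mu> \<nu> F G f g x y)) -
      (LINT y:- ball a r|\<mu>. (LINT x:ball a r|\<nu>. frame_kernel \<mu> \<nu> F G f g x y))" for a r
    using set_integral_difference_Fubini[of "ball a r" "ball a r" "frame_kernel \<mu> \<nu> F G f g",
        unfolded spaces integral_frame_kernel[OF assms(1,2,11,12)], folded Compl_eq_Diff_UNIV]
      assms(13) ball_sets
    unfolding kernel_integrable_def \<phi>_def \<psi>_def by blast+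
  have close: "\<forall>\<^sub>F r in at_top. \<forall>a. cmod ((LINT y:ball a r|\<mu>. \<phi> y) - (LINT x:ball a r|\<nu>. \<psi> x))
      \<le> \<epsilon> * (measure \<mu> (ball a r) + measure \<nu> (ball a r))" if \<epsilon>: "0 < \<epsilon>" for \<epsilon>
  proof -
    obtain R where R: "\<And>r a. R \<le> r \<Longrightarrow>
        ennreal (cmod ((LINT y:ball a r|\<mu>. \<phi> y) - (LINT x:ball a r|\<nu>. \<psi> x)))
        < ennreal \<epsilon> * (emeasure \<mu> (ball a r) + emeasure \<nu> (ball a r))"
      using assms(14) \<epsilon> unfolding localization_property_def Fubini(3)[symmetric] by blast
    show ?thesis
      using eventually_ge_at_top[of R]
    proof eventually_elim
      case (elim r)
      show ?case
      proof
        fix a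
        have "ennreal (cmod ((LINT y:ball a r|\<mu>. \<phi> y) - (LINT x:ball a r|\<nu>. \<psi> x)))
            < ennreal (\<epsilon> * (measure \<mu> (ball a r) + measure \<nu> (ball a r)))"
          using R[OF elim, of a] \<epsilon> by (simp add: em ennreal_mult)
        then show "cmod ((LINT y:ball a r|\<mu>. \<phi> y) - (LINT x:ball a r|\<nu>. \<psi> x))
            \<le> \<epsilon> * (measure \<mu> (ball a r) + measure \<nu> (ball a r))"
          by (simp add: ennreal_less_iff)
      qed
    qed
  qed
  have pos: "\<forall>\<^sub>F r in at_top. \<forall>a. 0 < measure \<mu> (ball a r)"
    "\<forall>\<^sub>F r in at_top. \<forall>a. 0 < measure \<nu> (ball a r)"
    using assms by (auto intro!: large_balls_positive_eventually)
  have \<psi>_le: "cmod (LINT x:ball a r|\<nu>. \<psi> x) \<le> measure \<nu> (ball a r)"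
    if "\<forall>x\<in>measure_support \<nu>. cmod (\<psi> x) \<le> 1" for a r
    by (intro norm_set_integral_le_measure AE_on_measure_support Fubini ball_sets ball_fin assms)
      (use that in auto)
  have \<phi>_ge: "measure \<mu> (ball a r) \<le> cmod (LINT y:ball a r|\<mu>. \<phi> y)"
    if "\<forall>y\<in>measure_support \<mu>. \<phi> y \<in> \<real> \<and> 1 \<le> Re (\<phi> y)" for a r
    by (intro measure_le_cmod_set_integral AE_on_measure_support Fubini ball_sets ball_fin assms)
      (use that in auto)
  have i: "lower_ball_average \<mu> \<phi> \<le> lower_density \<mu> \<nu> \<and> upper_ball_average \<mu> \<phi> \<le> upper_density \<mu> \<nu>"
    if \<psi>: "\<forall>x\<in>measure_support \<nu>. cmod (\<psi> x) \<le> 1"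
  proof -
    have "\<forall>\<^sub>F r in at_top. \<forall>a. cmod (LINT y:ball a r|\<mu>. \<phi> y) \<le> measure \<nu> (ball a r) +
        \<epsilon> * (measure \<mu> (ball a r) + cmod (LINT y:ball a r|\<mu>. \<phi> y) + measure \<nu> (ball a r))"
      if \<epsilon>: "0 < \<epsilon>" for \<epsilon>
      using close[OF \<epsilon>]
    proof eventually_elim
      case (elim r)
      show ?case
      proof
        fix a
        \<comment> \<open>The triangle inequality already gives the estimate with error
          \<epsilon>(\<mu>(B) + \<nu>(B)); this term is added only to match the shape required by
          \<open>ratio_bounds_transfer\<close>.\<close>
        have "0 \<le> \<epsilon> * cmod (LINT y:ball a r|\<mu>. \<phi> y)"
          using \<epsilon> by simp
        then show "cmod (LINT y:ball a r|\<mu>. \<phi> y) \<le> measure \<nu> (ball a r) +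
            \<epsilon> * (measure \<mu> (ball a r) + cmod (LINT y:ball a r|\<mu>. \<phi> y) + measure \<nu> (ball a r))"
          using elim[rule_format, of a] \<psi>_le[OF \<psi>, of a r]
            norm_triangle_sub[of "LINT y:ball a r|\<mu>. \<phi> y" "LINT x:ball a r|\<nu>. \<psi> x"]
          by (simp add: algebra_simps)
      qed
    qed
    then show ?thesis
      unfolding lower_ball_average_def lower_density_def upper_ball_average_def upper_density_def em
      using pos by (intro conjI ratio_bounds_transfer) simp_all
  qed
  have ii: "upper_density \<nu> \<mu> \<le> upper_ball_average \<nu> \<psi> \<and> lower_density \<nu> \<mu> \<le> lower_ball_average \<nu> \<psi>"
    if \<phi>: "\<forall>y\<in>measure_support \<mu>. \<phi> y \<in> \<real> \<and> 1 \<le> Re (\<phi> y)"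
  proof -
    \<comment> \<open>Here \<nu>(B) is the reference \<open>m\<close>, \<mu>(B) is \<open>p\<close>,
      and the modulus of the integral of \<open>\<psi>\<close> is \<open>q\<close>.\<close>
    have "\<forall>\<^sub>F r in at_top. \<forall>a. measure \<mu> (ball a r) \<le> cmod (LINT x:ball a r|\<nu>. \<psi> x) +
        \<epsilon> * (measure \<nu> (ball a r) + measure \<mu> (ball a r) + cmod (LINT x:ball a r|\<nu>. \<psi> x))"
      if \<epsilon>: "0 < \<epsilon>" for \<epsilon>
      using close[OF \<epsilon>]
    proof eventually_elim
      case (elim r)
      show ?case
      proof
        fix a
        have "0 \<le> \<epsilon> * cmod (LINT x:ball a r|\<nu>. \<psi> x)"
          using \<epsilon> by simp
        then show "measure \<mu> (ball a r) \<le> cmod (LINT x:ball a r|\<nu>. \<psi> x) +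
            \<epsilon> * (measure \<nu> (ball a r) + measure \<mu> (ball a r) + cmod (LINT x:ball a r|\<nu>. \<psi> x))"
          using elim[rule_format, of a] \<phi>_ge[OF \<phi>, of a r]
            norm_triangle_sub[of "LINT y:ball a r|\<mu>. \<phi> y" "LINT x:ball a r|\<nu>. \<psi> x"]
          by (simp add: algebra_simps)
      qed
    qed
    then show ?thesis
      unfolding lower_ball_average_def lower_density_def upper_ball_average_def upper_density_def em
      using pos by (intro conjI ratio_bounds_transfer) simp_all
  qed
  \<comment> \<open>For (iii): the ball averages in (i) and (ii) are themselves compared with 1, and
    chaining with \<open>i\<close> and \<open>ii\<close> gives the bounds on the densities.
    Positivity of large balls permits the division.\<close>
  have lower: "1 \<le> lower_ball_average \<mu> \<phi>"
    if \<phi>: "\<forall>y\<in>measure_support \<mu>. \<phi> y \<in> \<real> \<and> 1 \<le> Re (\<phi> y)"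
    unfolding lower_ball_average_def em
  proof (rule Liminf_bounded)
    show "\<forall>\<^sub>F r in at_top. 1 \<le> (INF a. ennreal (cmod (LINT y:ball a r|\<mu>. \<phi> y)) / ennreal (measure \<mu> (ball a r)))"
      using pos(1)
    proof eventually_elim
      case (elim r)
      then show ?case
        using \<phi>_ge[OF \<phi>] by (intro INF_greatest) (simp add: divide_ennreal)
    qed
  qed
  have upper: "upper_ball_average \<nu> \<psi> \<le> 1"
    if \<psi>: "\<forall>x\<in>measure_support \<nu>. cmod (\<psi> x) \<le> 1"
    unfolding upper_ball_average_def em
  proof (rule Limsup_bounded)
    show "\<forall>\<^sub>F r in at_top. (SUP a. ennreal (cmod (LINT x:ball a r|\<nu>. \<psi> x)) / ennreal (measure \<nu> (ball a r))) \<le> 1"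
      using pos(2)
    proof eventually_elim
      case (elim r)
      then show ?case
        using \<psi>_le[OF \<psi>] by (intro SUP_least) (simp add: divide_ennreal)
    qed
  qed
  show ?thesis
    unfolding \<phi>_def[symmetric] \<psi>_def[symmetric]
    using i ii lower upper by (meson order_trans)
qed

end
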